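(* Let $C$ be a proper cone in a Banach space $(X,\|\cdot\|)$, and let $(f_a)_{a\in\mathcal A}$ be a family of homogeneous maps $X\to X$. Assume that $(f_a)_{a\in\mathcal A}$ admits an upper selection and denote by $f=\sup_{a\in\mathcal A}f_a$ its supremum. Then $f$ is homogeneous and $$\hat r_C(f)\le\sup_{a\in\mathcal A}\hat r_C(f_a).$$ Assume further that the maps $f_a$ are continuous and order-preserving with respect to $C$, that $f$ is continuous and that $C$ is a normal cone. Then $f$ is order-preserving, and $$\sup_{a\in\mathcal A}r_C(f_a)\le r_C(f)\le\max\Big(\nu_C(f),\ \sup_{a\in\mathcal A}r_C(f_a)\Big).$$ In particular, when $\nu_C(f)<r_C(f)$, we have $$\hat r_C(f)=\sup_{a\in\mathcal A}\hat r_C(f_a)=\sup_{a\in\mathcal A}r_C(f_a)=r_C(f),$$ and the suprema over $a\in\mathcal A$ in this last display are attained.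
   Context: A subset $C$ of the real Banach space $X$ is a cone if $tC\subset C$ for all $t\ge 0$; it is proper if it is closed, convex and pointed ($C\cap(-C)=\{0\}$). A proper cone induces the partial order $x\le y\iff y-x\in C$. $C$ is normal if it is proper and there is a constant $M$ with $\|x\|\le M\|y\|$ whenever $0\le x\le y$. Homogeneous: $g(tx)=tg(x)$ for all $t>0$. Order-preserving: $x\le y$ implies $g(x)\le g(y)$. The family $(f_a)_{a\in\mathcal A}$ admits an upper selection if for all $x\in X$ there is $a_x\in\mathcal A$ such that $f_{a_x}(x)\ge f_b(x)$ for all $b\in\mathcal A$; its supremum is the map $f:X\to X$, $f(x)=f_{a_x}(x)$. For a homogeneous $g:X\to X$: $\hat r_C(g)=\sup\{\lambda\ge0\mid\exists x\in C\setminus\{0\},\ g(x)=\lambda x\}$ (supremum in $[0,+\infty]$); when $g(C)\subset C$ (automatic for continuous homogeneous order-preserving $g$), $r_C(g)=\sup_{x\in C}\limsup_{k\to\infty}\|g^k(x)\|^{1/k}$. Fix a homogeneous generalized measure of noncompactness $\nu$ on $X$, that is, a map $\nu$ from the bounded subsets of $X$ to $[0,\infty)$ such that, for all bounded $A,B\subset X$ and scalars $\lambda$: $\nu(A)=0$ iff $\operatorname{cl}A$ is compact; $\nu(A+B)\le\nu(A)+\nu(B)$; $\nu(\operatorname{cl}\operatorname{conv}A)=\nu(A)$; $\nu(\lambda A)=|\lambda|\nu(A)$; $A\subset B$ implies $\nu(A)\le\nu(B)$. Set $\nu_C(g)=\inf\{\lambda>0\mid \nu(g(A))\le\lambda\nu(A)\text{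 for all bounded }A\subset C\}$. *)

theory Defs
  imports "HOL-Analysis.Analysis"
begin

definition proper_cone :: "'a::real_normed_vector set \<Rightarrow> bool" where
  "proper_cone C \<longleftrightarrow> cone C \<and> closed C \<and> convex C \<and> C \<inter> uminus ` C = {0}"

definition cone_le :: "'a::real_normed_vector set \<Rightarrow> 'a \<Rightarrow> 'a \<Rightarrow> bool" where
  "cone_le C x y \<longleftrightarrow> y - x \<in> C"

definition normal_cone :: "'a::real_normed_vector set \<Rightarrow> bool" where
  "normal_cone C \<longleftrightarrow> proper_cone C \<and>
     (\<exists>M::real. \<forall>x y. cone_le C 0 x \<longrightarrow> cone_le C x y \<longrightarrow> norm x \<le> M * norm y)"

definition homogeneous :: "('a::real_normed_vector \<Rightarrow> 'a) \<Rightarrow> bool" where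
  "homogeneous g \<longleftrightarrow> (\<forall>t>0. \<forall>x. g (t *\<^sub>R x) = t *\<^sub>R g x)"

definition order_preserving :: "'a::real_normed_vector set \<Rightarrow> ('a \<Rightarrow> 'a) \<Rightarrow> bool" where
  "order_preserving C g \<longleftrightarrow> (\<forall>x y. cone_le C x y \<longrightarrow> cone_le C (g x) (g y))"

definition admits_upper_selection ::
    "'a::real_normed_vector set \<Rightarrow> 'i set \<Rightarrow> ('i \<Rightarrow> 'a \<Rightarrow> 'a) \<Rightarrow> bool" where
  "admits_upper_selection C A F \<longleftrightarrow>
     (\<forall>x. \<exists>a\<in>A. \<forall>b\<in>A. cone_le C (F b x) (F a x))"

text \<open>If \<open>C\<close> is proper, the order is antisymmetric, so the value below does not
  depend on the choice of the maximising index.\<close>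

definition family_sup ::
    "'a::real_normed_vector set \<Rightarrow> 'i set \<Rightarrow> ('i \<Rightarrow> 'a \<Rightarrow> 'a) \<Rightarrow> 'a \<Rightarrow> 'a" where
  "family_sup C A F x = F (SOME a. a \<in> A \<and> (\<forall>b\<in>A. cone_le C (F b x) (F a x))) x"

text \<open>Suprema and infima are taken in \<open>[0, \<infinity>]\<close>; in particular the supremum of the
  empty set is \<open>0\<close> and the infimum of the empty set is \<open>\<infinity>\<close>.\<close>

definition cone_eigenvalue_radius ::
    "'a::real_normed_vector set \<Rightarrow> ('a \<Rightarrow> 'a) \<Rightarrow> ennreal" where
  "cone_eigenvalue_radius C g =
     Sup (ennreal ` {l. 0 \<le> l \<and> (\<exists>x\<in>C - {0}. g x = l *\<^sub>R x)})"

definition cone_spectral_radius ::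
    "'a::real_normed_vector set \<Rightarrow> ('a \<Rightarrow> 'a) \<Rightarrow> ennreal" where
  "cone_spectral_radius C g =
     (SUP x\<in>C. limsup (\<lambda>k. ennreal (root k (norm ((g ^^ k) x)))))"

text \<open>Only the values of \<open>nu\<close> on bounded sets matter.\<close>

definition homogeneous_gmnc :: "('a::real_normed_vector set \<Rightarrow> real) \<Rightarrow> bool" where
  "homogeneous_gmnc nu \<longleftrightarrow>
     (\<forall>S. bounded S \<longrightarrow> 0 \<le> nu S) \<and>
     (\<forall>S. bounded S \<longrightarrow> (nu S = 0 \<longleftrightarrow> compact (closure S))) \<and>
     (\<forall>S T. bounded S \<longrightarrow> bounded T \<longrightarrow> nu {x + y |x y. x \<in> S \<and> y \<in> T} \<le> nu S + nu T) \<and>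
     (\<forall>S. bounded S \<longrightarrow> nu (closure (convex hull S)) = nu S) \<and>
     (\<forall>S c. bounded S \<longrightarrow> nu ((*\<^sub>R) c ` S) = \<bar>c\<bar> * nu S) \<and>
     (\<forall>S T. bounded S \<longrightarrow> bounded T \<longrightarrow> S \<subseteq> T \<longrightarrow> nu S \<le> nu T)"

text \<open>For continuous homogeneous \<open>g\<close>, as considered below, \<open>g ` S\<close> is bounded
  whenever \<open>S\<close> is, so \<open>nu\<close> is evaluated on bounded sets only.\<close>

definition cone_nu ::
    "('a::real_normed_vector set \<Rightarrow> real) \<Rightarrow> 'a set \<Rightarrow> ('a \<Rightarrow> 'a) \<Rightarrow> ennreal" where
  "cone_nu nu C g =
     Inf (ennreal ` {l. 0 < l \<and> (\<forall>S. bounded S \<longrightarrow> S \<subseteq> C \<longrightarrow> nu (g ` S) \<le> l * nu S)})"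

end

theory Submission
  imports Defs
begin

text \<open>Since \<open>f x\<close> is the value at \<open>x\<close> of some \<open>F a\<close>, every eigenvector of \<open>f\<close> is one of
  some \<open>F a\<close> for the same eigenvalue. The comparison of spectral radii follows from monotonicity
  and normality, so everything hinges on a nonlinear Krein-Rutman theorem: a continuous,
  homogeneous, order-preserving \<open>g\<close> with \<open>\<nu>\<^sub>C(g) < r = r\<^sub>C(g)\<close> has an eigenvector in the cone
  with eigenvalue \<open>r\<close>.

  No fixed point index is needed for it. For \<open>l\<close> slightly below \<open>r\<close>, the increasing iteration
  \<open>x\<^sub>0 = 0\<close>, \<open>x\<^sub>n\<^sub>+\<^sub>1 = (g x\<^sub>n + u) / l\<close> is unbounded for a suitable \<open>u\<close>; suitably normalised
  iterates form a relatively compact set, and letting \<open>l\<close> increase to \<open>r\<close> gives \<open>w \<noteq> 0\<close> in the cone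
  with \<open>g w \<ge> r w\<close>. If the increasing sequence \<open>g\<^sup>n w / r\<^sup>n\<close> is bounded, it converges to the
  desired eigenvector. Otherwise, for \<open>l > r\<close> the iteration with \<open>u = w\<close> converges to a solution of
  \<open>l x = g x + w\<close>; these solutions are unbounded as \<open>l\<close> decreases to \<open>r\<close>, and after normalisation
  they accumulate at an eigenvector.\<close>

section \<open>Growth rates of sequences and compactness of convergent sequences\<close>

lemma limsup_root_mono:
  fixes a b :: "nat \<Rightarrow> real"
  assumes ab: "\<And>n. a n \<le> M * b n" and M: "0 < M"
  shows "limsup (\<lambda>n. ennreal (root n (a n))) \<le> limsup (\<lambda>n. ennreal (root n (b n)))"
proof (rule dense_ge)
  fix y assume "limsup (\<lambda>n. ennreal (root n (b n))) < y"
  then obtain y' where y': "limsup (\<lambda>n. ennreal (root n (b n))) < y'" "y' < y"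
    using dense by blast
  then obtain c where c: "y' = ennreal c" "0 \<le> c"
    by (cases y') auto
  \<comment> \<open>A constant factor is lost in the limit because \<open>root n M\<close> tends to
    \<open>1\<close>. This is why normality constants never show up in spectral radii.\<close>
  have "(\<lambda>n. ennreal (root n M * c)) \<longlonglongrightarrow> ennreal (1 * c)"
    by (intro tendsto_intros tendsto_ennrealI LIMSEQ_root_const M)
  then have "\<forall>\<^sub>F n in sequentially. ennreal (root n M * c) < y"
    using y' c by (intro order_tendstoD(2)) auto
  moreover have "\<forall>\<^sub>F n in sequentially. ennreal (root n (b n)) < ennreal c"
    using y'(1) c by (auto dest: Limsup_lessD)
  ultimately have "\<forall>\<^sub>F n in sequentially. ennreal (root n (a n)) \<le> y"
    using eventually_gt_at_top[of 0]
  proof eventually_elim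
    case (elim n)
    have "root n (a n) \<le> root n M * root n (b n)"
      using ab[of n] elim by (simp flip: real_root_mult)
    also have "\<dots> \<le> root n M * c"
    proof (rule mult_left_mono)
      show "root n (b n) \<le> c"
        using elim(2) by (metis ennreal_leI leD linear)
    qed (use M elim in simp)
    finally show ?case
      using elim(1) ennreal_leI order.strict_implies_order order.trans by blast
  qed
  then show "limsup (\<lambda>n. ennreal (root n (a n))) \<le> y"
    by (rule Limsup_bounded)
qed

lemma limsup_root_power:
  assumes "0 \<le> (l::real)"
  shows "limsup (\<lambda>n. ennreal (root n (l ^ n))) = ennreal l"
proof -
  \<comment> \<open>Only eventually: \<open>root 0\<close> is \<open>0\<close> by
    convention.\<close>
  have "\<forall>\<^sub>F n in sequentially. ennreal (root n (l ^ n)) = ennreal l"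
    using eventually_gt_at_top[of 0]
  proof eventually_elim
    case (elim n)
    then show ?case
      using assms by (simp only: real_root_power_cancel)
  qed
  then have "limsup (\<lambda>n. ennreal (root n (l ^ n))) = limsup (\<lambda>n. ennreal l)"
    by (rule Limsup_eq)
  then show ?thesis
    by (simp only: Limsup_const[OF sequentially_bot])
qed

lemma unbounded_seq_exceeds:
  fixes X :: "nat \<Rightarrow> 'a::real_normed_vector"
  assumes "\<not> bounded (range X)"
  shows "\<exists>n. B \<le> norm (X n)"
  using assms unfolding bounded_iff by (metis linear rangeE)

lemma tendsto_inverse_Suc: "(\<lambda>n. 1 / (real n + 1)) \<longlonglongrightarrow> 0"
  using LIMSEQ_inverse_real_of_nat by (simp add: inverse_eq_divide add.commute)

lemma compact_insert_range:
  fixes X :: "nat \<Rightarrow> 'a::topological_space"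
  assumes X: "X \<longlonglongrightarrow> x"
  shows "compact (insert x (range X))"
proof (rule compactI)
  fix \<U> assume op: "\<forall>U\<in>\<U>. open U" and cover: "insert x (range X) \<subseteq> \<Union>\<U>"
  then obtain U where U: "U \<in> \<U>" "x \<in> U"
    by blast
  then obtain N where N: "\<And>n. n \<ge> N \<Longrightarrow> X n \<in> U"
    using topological_tendstoD[OF X] op unfolding eventually_sequentially by metis
  have "\<forall>n. \<exists>V\<in>\<U>. X n \<in> V"
    using cover by blast
  then obtain V where V: "\<And>n. V n \<in> \<U>" "\<And>n. X n \<in> V n"
    by metis
  have "X n \<in> \<Union>(insert U (V ` {..<N}))" for n
    using N[of n] V(2)[of n] by (cases "n < N") auto
  then have "insert x (range X) \<subseteq> \<Union>(insert U (V ` {..<N}))"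
    using U(2) by blast
  moreover have "insert U (V ` {..<N}) \<subseteq> \<U>"
    using U(1) V(1) by blast
  ultimately show "\<exists>\<V>\<subseteq>\<U>. finite \<V> \<and> insert x (range X) \<subseteq> \<Union>\<V>"
    by (intro exI[of _ "insert U (V ` {..<N})"]) simp
qed

section \<open>Order and convergence in a normal cone\<close>

locale normal_proper_cone =
  fixes C :: "'a::real_normed_vector set" and M :: real
  assumes proper: "proper_cone C"
    and normality: "\<And>x y. cone_le C 0 x \<Longrightarrow> cone_le C x y \<Longrightarrow> norm x \<le> M * norm y"
    and M_ge_1: "1 \<le> M"

text \<open>Enlarging the constant to \<open>max 1 M\<close> preserves the estimate and makes it
  safe to divide by it.\<close>

lemma normal_cone_locale:
  assumes "normal_cone C"
  obtains M where "normal_proper_cone C M"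
proof -
  obtain M where M: "proper_cone C"
    "\<And>x y. cone_le C 0 x \<Longrightarrow> cone_le C x y \<Longrightarrow> norm x \<le> M * norm y"
    using assms unfolding normal_cone_def by blast
  have "norm x \<le> max 1 M * norm y" if "cone_le C 0 x" "cone_le C x y" for x y
    using M(2)[OF that] by (smt (verit) mult_right_mono norm_ge_zero)
  with M(1) have "normal_proper_cone C (max 1 M)"
    by unfold_locales auto
  then show ?thesis ..
qed

context
  fixes C :: "'a::real_normed_vector set"
  assumes C: "proper_cone C"
begin

lemma cone_zero: "0 \<in> C"
  using C unfolding proper_cone_def by blast

lemma cone_scaleR: "x \<in> C \<Longrightarrow> 0 \<le> t \<Longrightarrow> t *\<^sub>R x \<in> C"
  using C mem_cone[of C x t] unfolding proper_cone_def by simp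

lemma cone_add:
  assumes "x \<in> C" "y \<in> C" shows "x + y \<in> C"
  using assms C convex_cone[of C] unfolding proper_cone_def by simp

lemma cone_le_refl: "cone_le C x x"
  by (simp add: cone_le_def cone_zero)

lemma cone_le_zero: "cone_le C 0 x \<longleftrightarrow> x \<in> C"
  by (simp add: cone_le_def)

lemma cone_le_trans: "cone_le C x y \<Longrightarrow> cone_le C y z \<Longrightarrow> cone_le C x z"
  unfolding cone_le_def using cone_add[of "y - x" "z - y"] by simp

lemma cone_le_antisym:
  assumes "cone_le C x y" "cone_le C y x" shows "x = y"
proof -
  have "x - y \<in> C \<inter> uminus ` C"
    using assms image_eqI[of "x - y" uminus "y - x" C] unfolding cone_le_def by simp
  then show ?thesis
    using C unfolding proper_cone_def by simp
qed

lemma cone_le_add: "cone_le C x y \<Longrightarrow> cone_le C x' y' \<Longrightarrow> cone_le C (x + x') (y + y')"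
  unfolding cone_le_def using cone_add[of "y - x" "y' - x'"] by (simp add: algebra_simps)

lemma cone_le_scaleR: "cone_le C x y \<Longrightarrow> 0 \<le> t \<Longrightarrow> cone_le C (t *\<^sub>R x) (t *\<^sub>R y)"
  unfolding cone_le_def using cone_scaleR[of "y - x" t] by (simp add: scaleR_diff_right)

lemma cone_le_tendsto:
  assumes "X \<longlonglongrightarrow> x" "Y \<longlonglongrightarrow> y" "\<forall>\<^sub>F n in sequentially. cone_le C (X n) (Y n)"
  shows "cone_le C x y"
  unfolding cone_le_def
proof (rule Lim_in_closed_set)
  show "(\<lambda>n. Y n - X n) \<longlonglongrightarrow> y - x"
    using assms(2,1) by (rule tendsto_diff)
qed (use assms(3) C in \<open>simp_all add: cone_le_def proper_cone_def\<close>)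

end

context normal_proper_cone
begin

lemmas cone_zero = cone_zero[OF proper]
  and cone_scaleR = cone_scaleR[OF proper]
  and cone_add = cone_add[OF proper]
  and le_refl = cone_le_refl[OF proper]
  and le_zero = cone_le_zero[OF proper]
  and le_trans = cone_le_trans[OF proper]
  and le_add = cone_le_add[OF proper]
  and le_scaleR = cone_le_scaleR[OF proper]
  and le_tendsto = cone_le_tendsto[OF proper]

lemma closed_cone: "closed C"
  using proper by (simp add: proper_cone_def)

lemma norm_mono: "x \<in> C \<Longrightarrow> cone_le C x y \<Longrightarrow> norm x \<le> M * norm y"
  using normality le_zero by blast

lemma le_in_cone: "x \<in> C \<Longrightarrow> cone_le C x y \<Longrightarrow> y \<in> C"
  using le_trans le_zero by blast

lemma le_chain:
  assumes "\<And>n. cone_le C (X n) (X (Suc n))" "m \<le> n"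
  shows "cone_le C (X m) (X n)"
  using assms(2) by (induction rule: dec_induct) (use assms(1) le_refl le_trans in blast)+

text \<open>Compactness only yields a convergent subsequence. Its limit dominates every term since
  the cone is closed, and normality, applied to \<open>x - X n\<close> below
  \<open>x - X (\<phi> i)\<close> for \<open>n \<ge> \<phi> i\<close>, extends the convergence to
  the whole sequence.\<close>

lemma increasing_convergent:
  assumes inc: "\<And>n. cone_le C (X n) (X (Suc n))"
    and comp: "compact (closure (range X))"
  obtains x where "X \<longlonglongrightarrow> x" "\<And>n. cone_le C (X n) x"
proof -
  obtain x \<phi> where \<phi>: "strict_mono \<phi>" "(X \<circ> \<phi>) \<longlonglongrightarrow> x"
    using seq_compactE[OF comp[unfolded compact_eq_seq_compact_metric], of X] closure_subset[of "range X"]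
    by blast
  have le: "cone_le C (X n) x" for n
  proof (rule le_tendsto[OF tendsto_const \<phi>(2)])
    show "\<forall>\<^sub>F i in sequentially. cone_le C (X n) ((X \<circ> \<phi>) i)"
      using eventually_ge_at_top[of n]
    proof eventually_elim
      case (elim i)
      then have "n \<le> \<phi> i"
        using seq_suble[OF \<phi>(1), of i] by simp
      then show ?case
        using le_chain[of X, OF inc] by simp
    qed
  qed
  have "X \<longlonglongrightarrow> x"
  proof (rule LIMSEQ_I)
    fix e :: real assume "0 < e"
    then have "0 < e / M"
      using M_ge_1 by simp
    from LIMSEQ_D[OF \<phi>(2) this] obtain i where i: "norm (X (\<phi> i) - x) < e / M"
      by auto
    have "norm (X n - x) < e" if "\<phi> i \<le> n" for n
    proof -
      have "cone_le C (x - X n) (x - X (\<phi> i))"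
        using le_chain[of X, OF inc that] by (simp add: cone_le_def)
      moreover have "x - X n \<in> C"
        using le[of n] by (simp add: cone_le_def)
      ultimately have "norm (x - X n) \<le> M * norm (x - X (\<phi> i))"
        by (rule norm_mono[rotated])
      also have "\<dots> < e"
        using i M_ge_1 by (simp add: norm_minus_commute pos_less_divide_eq mult.commute)
      finally show ?thesis
        by (simp add: norm_minus_commute)
    qed
    then show "\<exists>n0. \<forall>n\<ge>n0. norm (X n - x) < e"
      by (intro exI allI impI)
  qed
  then show ?thesis
    using le by (rule that)
qed

end

section \<open>Continuous, homogeneous, order-preserving maps\<close>

locale cone_map = normal_proper_cone C M for C :: "'a::real_normed_vector set" and M +
  fixes g :: "'a \<Rightarrow> 'a"
  assumes hom: "homogeneous g" and mono: "order_preserving C g"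
    and cont: "continuous_on UNIV g"
begin

lemma map_zero: "g 0 = 0"
proof -
  have "g 0 = 2 *\<^sub>R g 0"
    using hom[unfolded homogeneous_def, rule_format, of 2 0] by simp
  then show ?thesis
    by (metis scaleR_2 add_cancel_left_left)
qed

lemma map_scaleR: "0 \<le> t \<Longrightarrow> g (t *\<^sub>R x) = t *\<^sub>R g x"
  using hom unfolding homogeneous_def by (cases "t = 0") (auto simp: map_zero)

lemma map_mono: "cone_le C x y \<Longrightarrow> cone_le C (g x) (g y)"
  using mono unfolding order_preserving_def by blast

lemma map_cone: "x \<in> C \<Longrightarrow> g x \<in> C"
  using map_mono[of 0 x] by (simp add: le_zero map_zero)

lemma map_tendsto: "X \<longlonglongrightarrow> x \<Longrightarrow> (\<lambda>n. g (X n)) \<longlonglongrightarrow> g x"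
  using cont by (rule continuous_on_tendsto_compose) auto

text \<open>Continuity at \<open>0\<close> bounds \<open>g\<close> on a small ball, and rescaling
  \<open>x\<close> to norm \<open>d / 2\<close> spreads the bound by homogeneity.\<close>

lemma map_bound:
  obtains L where "0 < L" "\<And>x. norm (g x) \<le> L * norm x"
proof -
  obtain d where d: "0 < d" "\<And>x. norm x < d \<Longrightarrow> norm (g x) < 1"
    using cont[unfolded continuous_on_iff, rule_format, of 0 1] by (auto simp: map_zero)
  have "norm (g x) \<le> (2 / d) * norm x" for x
  proof (cases "x = 0")
    case False
    define t where "t = d / (2 * norm x)"
    have t: "0 < t" using False d(1) by (simp add: t_def)
    have "norm (t *\<^sub>R x) < d"
      using False d(1) by (simp add: t_def)
    from d(2)[OF this] have "t * norm (g x) < 1"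
      using t by (simp add: map_scaleR)
    then show ?thesis
      using False d(1) t by (simp add: t_def field_simps)
  qed (simp add: map_zero)
  then show ?thesis
    using d(1) that[of "2 / d"] by simp
qed

lemma bounded_image: "bounded S \<Longrightarrow> bounded (g ` S)"
proof -
  assume "bounded S"
  then obtain B where B: "\<And>x. x \<in> S \<Longrightarrow> norm x \<le> B"
    unfolding bounded_iff by blast
  obtain L where "0 < L" "\<And>x. norm (g x) \<le> L * norm x"
    using map_bound by blast
  then have "norm (g x) \<le> L * B" if "x \<in> S" for x
    using mult_left_mono[OF B[OF that], of L] by (meson less_imp_le order.trans)
  then show "bounded (g ` S)"
    unfolding bounded_iff by blast
qed

lemma funpow_cone: "x \<in> C \<Longrightarrow> (g ^^ n) x \<in> C"
  by (induction n) (auto simp: map_cone)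

lemma funpow_scaleR: "0 \<le> t \<Longrightarrow> (g ^^ n) (t *\<^sub>R x) = t *\<^sub>R (g ^^ n) x"
  by (induction n) (auto simp: map_scaleR)

lemma spectral_radius_finite: "cone_spectral_radius C g < top"
proof -
  obtain L where L: "0 < L" "\<And>x. norm (g x) \<le> L * norm x"
    using map_bound by blast
  have "limsup (\<lambda>k. ennreal (root k (norm ((g ^^ k) x)))) \<le> ennreal L" for x
  proof -
    \<comment> \<open>The \<open>+ 1\<close> keeps the constant positive at \<open>x = 0\<close>, as
      \<open>limsup_root_mono\<close> demands.\<close>
    have "norm ((g ^^ n) x) \<le> (norm x + 1) * L ^ n" for n
    proof (induction n)
      case (Suc n)
      have "norm ((g ^^ Suc n) x) \<le> L * norm ((g ^^ n) x)"
        using L(2) by simp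
      also have "\<dots> \<le> L * ((norm x + 1) * L ^ n)"
        using Suc L(1) by (intro mult_left_mono) auto
      finally show ?case by (simp add: mult_ac)
    qed simp
    then show ?thesis
      using limsup_root_mono[of "\<lambda>n. norm ((g ^^ n) x)" "norm x + 1" "\<lambda>n. L ^ n"]
        limsup_root_power[of L] L(1) by (simp add: add_nonneg_pos)
  qed
  then have "cone_spectral_radius C g \<le> ennreal L"
    unfolding cone_spectral_radius_def by (intro SUP_least)
  then show ?thesis
    using le_less_trans by fastforce
qed

text \<open>Monotonicity iterates the inequality to \<open>l ^ n *\<^sub>R x\<close> below
  \<open>(g ^^ n) x\<close>. Normality turns this into a lower bound for the norms, whose constant
  factor does not affect the growth rate.\<close>

lemma spectral_radius_ge:
  assumes "x \<in> C" "x \<noteq> 0" "0 \<le> l" "cone_le C (l *\<^sub>R x) (g x)"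
  shows "ennreal l \<le> cone_spectral_radius C g"
proof -
  have le: "cone_le C (l ^ n *\<^sub>R x) ((g ^^ n) x)" for n
  proof (induction n)
    case (Suc n)
    have "cone_le C (g (l ^ n *\<^sub>R x)) ((g ^^ Suc n) x)"
      using map_mono[OF Suc] by simp
    moreover have "cone_le C (l ^ Suc n *\<^sub>R x) (g (l ^ n *\<^sub>R x))"
      using le_scaleR[OF assms(4), of "l ^ n"] assms(3) by (simp add: map_scaleR mult.commute)
    ultimately show ?case
      using le_trans by blast
  qed (simp add: le_refl)
  have "l ^ n \<le> M / norm x * norm ((g ^^ n) x)" for n
    using norm_mono[OF cone_scaleR[OF assms(1)] le, of n] assms(2,3) by (simp add: field_simps)
  then have "ennreal l \<le> limsup (\<lambda>k. ennreal (root k (norm ((g ^^ k) x))))"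
    using limsup_root_mono[of "\<lambda>n. l ^ n" "M / norm x" "\<lambda>n. norm ((g ^^ n) x)"]
      limsup_root_power[OF assms(3)] M_ge_1 assms(2) by simp
  then show ?thesis
    unfolding cone_spectral_radius_def using assms(1) by (rule SUP_upper2[rotated])
qed

lemma eigenvalue_radius_le_spectral_radius: "cone_eigenvalue_radius C g \<le> cone_spectral_radius C g"
  unfolding cone_eigenvalue_radius_def
proof (rule Sup_least)
  fix e assume "e \<in> ennreal ` {l. 0 \<le> l \<and> (\<exists>x\<in>C - {0}. g x = l *\<^sub>R x)}"
  then obtain l x where "e = ennreal l" "0 \<le> l" "x \<in> C" "x \<noteq> 0" "g x = l *\<^sub>R x"
    by blast
  then show "e \<le> cone_spectral_radius C g"
    using spectral_radius_ge[of x l] by (simp add: le_refl)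
qed

lemma spectral_radius_mono:
  assumes h: "\<And>x. x \<in> C \<Longrightarrow> h x \<in> C" "\<And>x. x \<in> C \<Longrightarrow> cone_le C (h x) (g x)"
  shows "cone_spectral_radius C h \<le> cone_spectral_radius C g"
  unfolding cone_spectral_radius_def
proof (rule SUP_mono)
  fix x assume x: "x \<in> C"
  have hC: "(h ^^ n) x \<in> C" for n
    using x h(1) by (induction n) auto
  have "cone_le C ((h ^^ n) x) ((g ^^ n) x)" for n
  proof (induction n)
    case (Suc n)
    show ?case
      using le_trans[OF h(2)[OF hC[of n]] map_mono[OF Suc]] by simp
  qed (simp add: le_refl)
  then have "norm ((h ^^ n) x) \<le> M * norm ((g ^^ n) x)" for n
    using hC by (intro norm_mono)
  then have "limsup (\<lambda>k. ennreal (root k (norm ((h ^^ k) x))))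
      \<le> limsup (\<lambda>k. ennreal (root k (norm ((g ^^ k) x))))"
    using M_ge_1 by (intro limsup_root_mono) auto
  with x show "\<exists>y\<in>C. limsup (\<lambda>k. ennreal (root k (norm ((h ^^ k) x))))
      \<le> limsup (\<lambda>k. ennreal (root k (norm ((g ^^ k) y))))"
    by blast
qed

text \<open>Approximation from below to a solution of \<open>l *\<^sub>R x = g x + u\<close>. For
  linear \<open>g\<close> these are the partial sums of the Neumann series of the resolvent at
  \<open>l\<close>, applied to \<open>u\<close>.\<close>

primrec affine_iter :: "real \<Rightarrow> 'a \<Rightarrow> nat \<Rightarrow> 'a" where
  "affine_iter l u 0 = 0"
| "affine_iter l u (Suc n) = (1 / l) *\<^sub>R (g (affine_iter l u n) + u)"

context
  fixes l :: real and u :: 'a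
  assumes l: "0 < l" and u: "u \<in> C"
begin

lemma affine_iter_cone: "affine_iter l u n \<in> C"
  by (induction n) (use l u in \<open>auto intro!: cone_zero cone_scaleR cone_add map_cone\<close>)

lemma affine_iter_inc: "cone_le C (affine_iter l u n) (affine_iter l u (Suc n))"
proof (induction n)
  case 0
  then show ?case
    using affine_iter_cone[of 1] by (simp add: le_zero)
next
  case (Suc n)
  have "cone_le C (g (affine_iter l u n) + u) (g (affine_iter l u (Suc n)) + u)"
    using Suc by (intro le_add map_mono le_refl)
  then show ?case
    using l by (auto intro: le_scaleR)
qed

text \<open>For linear \<open>g\<close> the left side is the last term of the Neumann partial sum.
  In general it is what remains when the added \<open>u\<close> is dropped in every step after the
  first.\<close>

lemma affine_iter_ge: "cone_le C ((1 / l) ^ Suc n *\<^sub>R (g ^^ n) u) (affine_iter l u (Suc n))"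
proof (induction n)
  case 0
  then show ?case by (simp add: map_zero le_refl)
next
  case (Suc n)
  have "cone_le C (g ((1 / l) ^ Suc n *\<^sub>R (g ^^ n) u) + 0) (g (affine_iter l u (Suc n)) + u)"
    using Suc u by (intro le_add map_mono) (auto simp: le_zero)
  then have "cone_le C ((1 / l) *\<^sub>R (g ((1 / l) ^ Suc n *\<^sub>R (g ^^ n) u) + 0)) (affine_iter l u (Suc (Suc n)))"
    using l by (auto intro: le_scaleR)
  moreover have "(1 / l) *\<^sub>R (g ((1 / l) ^ Suc n *\<^sub>R (g ^^ n) u) + 0) = (1 / l) ^ Suc (Suc n) *\<^sub>R (g ^^ Suc n) u"
    using l by (subst map_scaleR) auto
  ultimately show ?case by simp
qed

text \<open>By \<open>affine_iter_ge\<close> and normality, bounded iterates would make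
  \<open>norm ((g ^^ n) u)\<close> at most a constant times \<open>l ^ n\<close>.\<close>

lemma affine_iter_unbounded:
  assumes "ennreal l < limsup (\<lambda>k. ennreal (root k (norm ((g ^^ k) u))))"
  shows "\<not> bounded (range (affine_iter l u))"
proof
  assume "bounded (range (affine_iter l u))"
  then obtain B where B: "0 < B" "\<And>n. norm (affine_iter l u n) \<le> B"
    unfolding bounded_pos by auto
  have "norm ((g ^^ n) u) \<le> (M * B * l) * l ^ n" for n
  proof -
    have "norm ((1 / l) ^ Suc n *\<^sub>R (g ^^ n) u) \<le> M * norm (affine_iter l u (Suc n))"
      using l u by (intro norm_mono affine_iter_ge cone_scaleR funpow_cone) auto
    also have "\<dots> \<le> M * B"
      using B(2)[of "Suc n"] M_ge_1 by (intro mult_left_mono) auto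
    finally show ?thesis
      using l by (simp add: field_simps power_divide)
  qed
  then have "limsup (\<lambda>k. ennreal (root k (norm ((g ^^ k) u)))) \<le> ennreal l"
    using limsup_root_mono[of "\<lambda>n. norm ((g ^^ n) u)" "M * B * l" "\<lambda>n. l ^ n"]
      limsup_root_power[of l] l B(1) M_ge_1 by simp
  with assms show False by simp
qed

end

end

section \<open>Condensing maps: compactness and existence of eigenvectors\<close>

locale condensing_cone_map = cone_map C M g
  for C :: "'a::real_normed_vector set" and M g +
  fixes nu :: "'a set \<Rightarrow> real" and k :: real
  assumes gmnc: "homogeneous_gmnc nu" and k_pos: "0 < k"
    and condensing: "\<And>S. bounded S \<Longrightarrow> S \<subseteq> C \<Longrightarrow> nu (g ` S) \<le> k * nu S"
begin

lemma nu_nonneg: "bounded S \<Longrightarrow> 0 \<le> nu S"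
  and nu_zero: "bounded S \<Longrightarrow> nu S = 0 \<longleftrightarrow> compact (closure S)"
  and nu_add: "bounded S \<Longrightarrow> bounded T \<Longrightarrow> nu {x + y |x y. x \<in> S \<and> y \<in> T} \<le> nu S + nu T"
  and nu_hull: "bounded S \<Longrightarrow> nu (closure (convex hull S)) = nu S"
  and nu_scaleR: "bounded S \<Longrightarrow> nu ((*\<^sub>R) c ` S) = \<bar>c\<bar> * nu S"
  and nu_mono: "bounded S \<Longrightarrow> bounded T \<Longrightarrow> S \<subseteq> T \<Longrightarrow> nu S \<le> nu T"
  using gmnc unfolding homogeneous_gmnc_def by simp_all

lemma nu_compact: "compact K \<Longrightarrow> nu K = 0"
  using nu_zero[of K] by (simp add: compact_imp_bounded compact_imp_closed closure_closed)

lemma nu_add_compact: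
  assumes "bounded S" "compact K"
  shows "nu {x + y |x y. x \<in> S \<and> y \<in> K} \<le> nu S"
  using nu_add[of S K] assms nu_compact[of K] by (simp add: compact_imp_bounded)

lemma nu_insert:
  assumes S: "bounded S" "S \<noteq> {}"
  shows "nu (insert x S) \<le> nu S"
proof -
  obtain a where a: "a \<in> S"
    using S by blast
  \<comment> \<open>No maximum property of \<open>nu\<close> is assumed, hence the detour through a sum with a compact set.\<close>
  let ?T = "{y + z |y z. y \<in> S \<and> z \<in> {0, x - a}}"
  have T: "?T = S \<union> (\<lambda>y. y + (x - a)) ` S"
    by (auto) (metis add.right_neutral)
  have bdd: "bounded ?T"
    unfolding T using S(1) bounded_translation[OF S(1), of "x - a"] by (simp add: add.commute)
  have "insert x S \<subseteq> ?T"
    unfolding T using a image_eqI[of x "\<lambda>y. y + (x - a)" a S] by auto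
  then have "nu (insert x S) \<le> nu ?T"
    using S(1) bdd by (intro nu_mono) auto
  also have "\<dots> \<le> nu S"
    using S(1) by (intro nu_add_compact) auto
  finally show ?thesis .
qed

text \<open>Each element of \<open>Y\<close> lies on a segment from \<open>0\<close> to a point of \<open>(g ` Y + K) / l\<close>, so
  \<open>nu Y \<le> (k / l) * nu Y\<close>.\<close>

lemma precompact:
  assumes Y: "bounded Y" "Y \<subseteq> C" and K: "compact K" and l: "k < l"
    and rep: "\<And>y. y \<in> Y \<Longrightarrow> y = 0 \<or> (\<exists>y'\<in>Y. \<exists>z\<in>K. \<exists>m\<ge>l. m *\<^sub>R y = g y' + z)"
  shows "compact (closure Y)"
proof (cases "Y = {} \<or> K = {}")
  \<comment> \<open>If \<open>Y\<close> or \<open>K\<close> is empty, \<open>rep\<close> leaves at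
    most the point \<open>0\<close>. Setting this case aside makes \<open>B\<close> nonempty, which
    \<open>nu_insert\<close> requires.\<close>
  case True
  then have "Y \<subseteq> {0}"
    using rep by auto
  then have "finite Y"
    using finite_subset by blast
  then show ?thesis
    by (simp add: finite_imp_closed finite_imp_compact closure_closed)
next
  case False
  have l0: "0 < l"
    using l k_pos by simp
  define B where "B = {x + z |x z. x \<in> g ` Y \<and> z \<in> K}"
  define D where "D = insert 0 ((*\<^sub>R) (1 / l) ` B)"
  have gY: "bounded (g ` Y)"
    using Y(1) by (rule bounded_image)
  have "B = (\<Union>x\<in>g ` Y. \<Union>z\<in>K. {x + z})"
    unfolding B_def by blast
  then have B: "bounded B"
    using bounded_sums[OF gY compact_imp_bounded[OF K]] by simp
  have B_ne: "B \<noteq> {}"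
    using False by (auto simp: B_def)
  have sB: "bounded ((*\<^sub>R) (1 / l) ` B)"
    using B by (rule bounded_scaling)
  have D: "bounded D"
    using sB by (simp add: D_def)
  have sub: "Y \<subseteq> convex hull D"
  proof
    fix y assume "y \<in> Y"
    from rep[OF this] show "y \<in> convex hull D"
    proof
      assume "y = 0"
      then show ?thesis
        by (simp add: D_def hull_inc)
    next
      assume "\<exists>y'\<in>Y. \<exists>z\<in>K. \<exists>m\<ge>l. m *\<^sub>R y = g y' + z"
      then obtain y' z m where *: "y' \<in> Y" "z \<in> K" "l \<le> m" "m *\<^sub>R y = g y' + z"
        by blast
      have "g y' + z \<in> B"
        using * by (auto simp: B_def)
      then have "(1 / l) *\<^sub>R (g y' + z) \<in> convex hull D"
        unfolding D_def by (intro hull_inc insertI2 imageI)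
      moreover have "0 \<in> convex hull D"
        by (intro hull_inc) (simp add: D_def)
      \<comment> \<open>The factors \<open>m\<close> vary with \<open>y\<close>; since
        \<open>l \<le> m\<close>, the quotient \<open>l / m\<close> is a convex weight, so the
        single factor \<open>l\<close> serves all points once \<open>0\<close> is adjoined.\<close>
      moreover have "y = (1 - l / m) *\<^sub>R 0 + (l / m) *\<^sub>R ((1 / l) *\<^sub>R (g y' + z))"
        using * l0 by (simp flip: *(4))
      ultimately show ?thesis
        using *(3) l0 convexD[OF convex_convex_hull, of 0 D "(1 / l) *\<^sub>R (g y' + z)" "1 - l / m" "l / m"]
        by simp
    qed
  qed
  have hull: "bounded (closure (convex hull D))"
    using D by (simp add: bounded_closure bounded_convex_hull)
  have "nu Y \<le> nu (closure (convex hull D))"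
    using Y(1) hull sub closure_subset by (intro nu_mono) auto
  also have "\<dots> = nu D"
    using D by (rule nu_hull)
  also have "\<dots> \<le> nu ((*\<^sub>R) (1 / l) ` B)"
    unfolding D_def using sB B_ne by (intro nu_insert) auto
  also have "\<dots> = 1 / l * nu B"
    using nu_scaleR[OF B, of "1 / l"] l0 by simp
  also have "\<dots> \<le> 1 / l * (k * nu Y)"
    using nu_add_compact[OF gY K] condensing[OF Y] l0
    by (intro mult_left_mono) (simp_all add: B_def)
  finally have "nu Y \<le> 1 / l * (k * nu Y)" .
  then have "(l - k) * nu Y \<le> 0"
    using l0 by (simp add: field_simps)
  then have "nu Y = 0"
    using l nu_nonneg[OF Y(1)] by (simp add: mult_le_0_iff)
  then show ?thesis
    using nu_zero[OF Y(1)] by simp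
qed

text \<open>The scaling factors \<open>s\<close> in \<open>Y\<close> below keep all earlier iterates in the unit ball, so that
  \<open>Y\<close> contains the predecessor of each of its points. By normality, \<open>s = 1 / (M * norm x\<^sub>n)\<close> is
  such a factor for \<open>x\<^sub>n\<close>, and it leaves the norm \<open>1 / M\<close>.\<close>

lemma superharmonic_limit:
  assumes lj: "\<And>j. l0 \<le> l j" "k < l0" "l \<longlonglongrightarrow> l'"
    and K: "compact K" "K \<subseteq> C" and u: "\<And>j. u j \<in> K"
    and unb: "\<And>j. \<not> bounded (range (affine_iter (l j) (u j)))"
  obtains w where "w \<in> C" "w \<noteq> 0" "cone_le C (l' *\<^sub>R w) (g w)"
proof -
  let ?x = "\<lambda>j n. affine_iter (l j) (u j) n"
  have l_pos: "0 < l j" for j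
    using lj(1)[of j] lj(2) k_pos by linarith
  have uC: "u j \<in> C" for j
    using u K(2) by blast
  define Y where "Y = {s *\<^sub>R ?x j n |s j n. 0 \<le> s \<and> s \<le> 1 \<and> (\<forall>m\<le>n. norm (s *\<^sub>R ?x j m) \<le> 1)}"
  \<comment> \<open>The inhomogeneous terms get scaled by \<open>s\<close> as well;
    \<open>K'\<close> is a compact set containing all of them.\<close>
  define K' where "K' = (\<lambda>(s, z). s *\<^sub>R z) ` ({0..1} \<times> K)"
  have K': "compact K'"
    unfolding K'_def using K(1)
    by (intro compact_continuous_image compact_Times)
      (auto simp: case_prod_beta intro!: continuous_intros)
  have Y: "compact (closure Y)"
  proof (rule precompact[OF _ _ K' lj(2)])
    have "norm y \<le> 1" if "y \<in> Y" for y
      using that unfolding Y_def by blast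
    then show "bounded Y"
      unfolding bounded_iff by blast
    show "Y \<subseteq> C"
      using affine_iter_cone[OF l_pos uC] cone_scaleR by (auto simp: Y_def)
    fix y assume "y \<in> Y"
    then obtain s j n where y: "y = s *\<^sub>R ?x j n" "0 \<le> s" "s \<le> 1"
      "\<And>m. m \<le> n \<Longrightarrow> norm (s *\<^sub>R ?x j m) \<le> 1"
      unfolding Y_def by blast
    show "y = 0 \<or> (\<exists>y'\<in>Y. \<exists>z\<in>K'. \<exists>m\<ge>l0. m *\<^sub>R y = g y' + z)"
    proof (cases n)
      case (Suc n')
      have "s *\<^sub>R ?x j n' \<in> Y"
        unfolding Y_def using y Suc by (intro CollectI exI[of _ s] exI[of _ j] exI[of _ n']) auto
      moreover have "s *\<^sub>R u j \<in> K'"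
        unfolding K'_def using y u by (auto intro!: image_eqI[of _ _ "(s, u j)"])
      moreover have "l j *\<^sub>R y = g (s *\<^sub>R ?x j n') + s *\<^sub>R u j"
        using y(1,2) l_pos[of j] Suc by (simp add: map_scaleR scaleR_add_right)
      ultimately show ?thesis
        using lj(1)[of j] by blast
    qed (simp add: y)
  qed
  have "\<forall>j. \<exists>n. real j + 1 \<le> norm (?x j n)"
    using unbounded_seq_exceeds[OF unb] by blast
  then obtain n where n: "\<And>j. real j + 1 \<le> norm (?x j (n j))"
    by metis
  define s where "s j = 1 / (M * norm (?x j (n j)))" for j
  define y where "y j = s j *\<^sub>R ?x j (n j)" for j
  have M_pos: "0 < M"
    using M_ge_1 by simp
  have x_ge: "1 \<le> norm (?x j (n j))" for j
    using n[of j] by simp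
  have prod_ge: "real j + 1 \<le> M * norm (?x j (n j))" for j
    using mult_mono[of 1 M "real j + 1" "norm (?x j (n j))"] n[of j] M_ge_1 by simp
  have s: "0 \<le> s j" "s j \<le> 1" "s j \<le> 1 / (real j + 1)" for j
    using prod_ge[of j] M_pos unfolding s_def
    by (simp_all add: divide_le_eq_1 frac_le)
  have norm_y: "norm (y j) = 1 / M" for j
    using M_pos x_ge[of j] by (auto simp: y_def s_def)
  have "norm (s j *\<^sub>R ?x j m) \<le> 1" if "m \<le> n j" for j m
  proof -
    have "cone_le C (?x j m) (?x j (n j))"
      using affine_iter_inc[OF l_pos uC] that by (rule le_chain)
    then have "norm (?x j m) \<le> M * norm (?x j (n j))"
      using affine_iter_cone[OF l_pos uC] by (intro norm_mono)
    then show ?thesis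
      using M_pos x_ge[of j] prod_ge[of j] by (simp add: s_def divide_le_eq_1)
  qed
  then have yY: "y j \<in> Y" for j
    unfolding Y_def y_def using s by blast
  then have "\<forall>j. y j \<in> closure Y"
    using closure_subset[of Y] by blast
  then obtain w \<phi> where \<phi>: "strict_mono \<phi>" "(y \<circ> \<phi>) \<longlonglongrightarrow> w"
    using seq_compactE[OF Y[unfolded compact_eq_seq_compact_metric]] by blast
  have yC: "y j \<in> C" for j
    unfolding y_def using affine_iter_cone[OF l_pos uC] s by (intro cone_scaleR)
  have "w \<in> C"
    by (rule closed_sequentially[OF closed_cone _ \<phi>(2)]) (simp add: yC)
  moreover have "norm w = 1 / M"
    using tendsto_norm[OF \<phi>(2)] norm_y by (simp add: o_def LIMSEQ_const_iff)
  then have "w \<noteq> 0"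
    using M_pos by auto
  moreover have "cone_le C (l' *\<^sub>R w) (g w + 0)"
  proof (rule le_tendsto)
    show "(\<lambda>i. l (\<phi> i) *\<^sub>R y (\<phi> i)) \<longlonglongrightarrow> l' *\<^sub>R w"
      using LIMSEQ_subseq_LIMSEQ[OF lj(3) \<phi>(1)] \<phi>(2) by (intro tendsto_scaleR) (auto simp: o_def)
    have "s \<longlonglongrightarrow> 0"
      using tendsto_inverse_Suc by (rule Lim_null_comparison[rotated]) (use s in simp)
    moreover obtain b where "\<And>z. z \<in> K \<Longrightarrow> norm z \<le> b"
      using compact_imp_bounded[OF K(1)] unfolding bounded_iff by blast
    then have "Bfun u sequentially"
      using u by (intro BfunI[of _ b]) simp
    ultimately have "(\<lambda>j. s j *\<^sub>R u j) \<longlonglongrightarrow> 0"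
      using bounded_bilinear.Zfun_prod_Bfun[OF bounded_bilinear_scaleR] by (auto simp: tendsto_Zfun_iff)
    then show "(\<lambda>i. g (y (\<phi> i)) + s (\<phi> i) *\<^sub>R u (\<phi> i)) \<longlonglongrightarrow> g w + 0"
      using \<phi> by (intro tendsto_add map_tendsto) (auto simp: o_def dest: LIMSEQ_subseq_LIMSEQ)
    \<comment> \<open>This is the monotonicity of the iteration at \<open>n j\<close>, multiplied by
      \<open>s j * l j\<close>. The term with \<open>u j\<close> vanishes in the limit because
      \<open>s j\<close> tends to \<open>0\<close>.\<close>
    have "cone_le C (l j *\<^sub>R y j) (g (y j) + s j *\<^sub>R u j)" for j
    proof -
      have "cone_le C ((s j * l j) *\<^sub>R ?x j (n j)) ((s j * l j) *\<^sub>R ?x j (Suc (n j)))"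
        using affine_iter_inc[OF l_pos uC] s(1) l_pos[of j] by (intro le_scaleR) auto
      then show ?thesis
        using s(1)[of j] l_pos[of j] by (simp add: y_def map_scaleR scaleR_add_right mult.commute)
    qed
    then show "\<forall>\<^sub>F i in sequentially. cone_le C (l (\<phi> i) *\<^sub>R y (\<phi> i)) (g (y (\<phi> i)) + s (\<phi> i) *\<^sub>R u (\<phi> i))"
      by simp
  qed
  ultimately show ?thesis
    using that by simp
qed

text \<open>The rescaled iterates \<open>v n\<close> increase and satisfy
  \<open>r *\<^sub>R v (Suc n) = g (v n)\<close>. Once \<open>precompact\<close> applies they
  converge, and the limit is nonzero because it dominates \<open>w\<close>.\<close>

lemma bounded_iteration_eigenvector:
  assumes r: "k < r" and w: "w \<in> C" "w \<noteq> 0" "cone_le C (r *\<^sub>R w) (g w)"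
    and bdd: "bounded (range (\<lambda>n. (1 / r) ^ n *\<^sub>R (g ^^ n) w))"
  obtains x where "x \<in> C" "x \<noteq> 0" "g x = r *\<^sub>R x"
proof -
  have r_pos: "0 < r"
    using r k_pos by simp
  define v where "v n = (1 / r) ^ n *\<^sub>R (g ^^ n) w" for n
  have v_Suc: "r *\<^sub>R v (Suc n) = g (v n)" for n
    using r_pos by (simp add: v_def map_scaleR)
  have vC: "v n \<in> C" for n
    unfolding v_def using r_pos w(1) by (intro cone_scaleR funpow_cone) auto
  have scale_le: "cone_le C x y" if "cone_le C (r *\<^sub>R x) (r *\<^sub>R y)" for x y
    using le_scaleR[OF that, of "1 / r"] r_pos by simp
  have inc: "cone_le C (v n) (v (Suc n))" for n
  proof (induction n)
    case 0
    have "cone_le C (r *\<^sub>R v 0) (r *\<^sub>R v (Suc 0))"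
      unfolding v_Suc using w(3) by (simp add: v_def)
    then show ?case by (rule scale_le)
  next
    case (Suc n)
    have "cone_le C (r *\<^sub>R v (Suc n)) (r *\<^sub>R v (Suc (Suc n)))"
      unfolding v_Suc using Suc by (rule map_mono)
    then show ?case by (rule scale_le)
  qed
  have "compact (closure (range v))"
  proof (rule precompact[OF _ _ _ r])
    show "bounded (range v)"
      using bdd by (simp add: v_def[abs_def])
    \<comment> \<open>For \<open>precompact\<close>, the starting point \<open>v 0 = w\<close>,
      which comes with no predecessor, is made its own predecessor at the cost of the term
      \<open>r *\<^sub>R w - g w\<close>.\<close>
    show "range v \<subseteq> C"
      using vC by blast
    show "compact {0, r *\<^sub>R w - g w}"
      by simp
    fix y assume "y \<in> range v"
    then obtain n where n: "y = v n" by blast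
    show "y = 0 \<or> (\<exists>y'\<in>range v. \<exists>z\<in>{0, r *\<^sub>R w - g w}. \<exists>m\<ge>r. m *\<^sub>R y = g y' + z)"
    proof (cases n)
      case 0
      then have "r *\<^sub>R y = g (v 0) + (r *\<^sub>R w - g w)"
        using n by (simp add: v_def)
      then show ?thesis by blast
    next
      case (Suc n')
      then have "r *\<^sub>R y = g (v n') + 0"
        using n v_Suc by simp
      then show ?thesis by blast
    qed
  qed
  then obtain x where x: "v \<longlonglongrightarrow> x" "\<And>n. cone_le C (v n) x"
    using increasing_convergent[of v, OF inc] by metis
  have "(\<lambda>n. r *\<^sub>R v (Suc n)) \<longlonglongrightarrow> r *\<^sub>R x"
    using x(1) by (intro tendsto_intros LIMSEQ_Suc)
  moreover have "(\<lambda>n. r *\<^sub>R v (Suc n)) \<longlonglongrightarrow> g x"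
    unfolding v_Suc using x(1) by (rule map_tendsto)
  ultimately have "g x = r *\<^sub>R x"
    by (rule LIMSEQ_unique[symmetric])
  moreover have wx: "cone_le C w x"
    using x(2)[of 0] by (simp add: v_def)
  then have "x \<in> C" "x \<noteq> 0"
    using le_in_cone[OF w(1)] norm_mono[OF w(1)] w(2) by fastforce+
  ultimately show ?thesis
    using that by blast
qed

text \<open>If the iterates were unbounded, \<open>superharmonic_limit\<close> with constant
  sequences would give a nonzero \<open>w\<close> with \<open>g w\<close> above
  \<open>l *\<^sub>R w\<close>, contradicting \<open>spectral_radius_ge\<close>. Bounded iterates
  are precompact, hence convergent.\<close>

lemma affine_iter_fixpoint:
  assumes l: "k < l" "0 < l" "cone_spectral_radius C g < ennreal l" and u: "u \<in> C"
  obtains x where "l *\<^sub>R x = g x + u" "\<And>n. cone_le C (affine_iter l u n) x"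
proof -
  have "bounded (range (affine_iter l u))"
  proof (rule ccontr)
    assume "\<not> bounded (range (affine_iter l u))"
    then obtain w where w: "w \<in> C" "w \<noteq> 0" "cone_le C (l *\<^sub>R w) (g w)"
      using superharmonic_limit[of l "\<lambda>_. l" l "{u}" "\<lambda>_. u"] l(1) u by auto
    with spectral_radius_ge[OF w(1,2) _ w(3)] l show False
      by simp
  qed
  then have "compact (closure (range (affine_iter l u)))"
  proof (rule precompact[OF _ _ _ l(1)])
    show "range (affine_iter l u) \<subseteq> C"
      using affine_iter_cone[OF l(2) u] by blast
    show "compact {u}"
      by simp
    fix y assume "y \<in> range (affine_iter l u)"
    then obtain n where n: "y = affine_iter l u n" by blast
    show "y = 0 \<or> (\<exists>y'\<in>range (affine_iter l u). \<exists>z\<in>{u}. \<exists>m\<ge>l. m *\<^sub>R y = g y' + z)"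
    proof (cases n)
      case (Suc n')
      then have "l *\<^sub>R y = g (affine_iter l u n') + u"
        using n l(2) by simp
      then show ?thesis by blast
    qed (simp add: n)
  qed
  then obtain x where x: "affine_iter l u \<longlonglongrightarrow> x" "\<And>n. cone_le C (affine_iter l u n) x"
    using increasing_convergent[of "affine_iter l u", OF affine_iter_inc[OF l(2) u]] by metis
  have "(\<lambda>n. l *\<^sub>R affine_iter l u (Suc n)) \<longlonglongrightarrow> l *\<^sub>R x"
    using x(1) by (intro tendsto_intros LIMSEQ_Suc)
  moreover have "(\<lambda>n. l *\<^sub>R affine_iter l u (Suc n)) \<longlonglongrightarrow> g x + u"
    using l(2) x(1) by (auto intro!: tendsto_intros map_tendsto)
  ultimately have "l *\<^sub>R x = g x + u"
    by (rule LIMSEQ_unique)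
  then show ?thesis
    using x(2) that by blast
qed

lemma unbounded_iteration_eigenvector:
  assumes r: "k < r" "cone_spectral_radius C g = ennreal r" and w: "w \<in> C"
    and unb: "\<not> bounded (range (\<lambda>n. (1 / r) ^ n *\<^sub>R (g ^^ n) w))"
  obtains x where "x \<in> C" "x \<noteq> 0" "g x = r *\<^sub>R x"
proof -
  have r_pos: "0 < r"
    using r k_pos by simp
  define l where "l j = r + 1 / (real j + 1)" for j
  have l_gr: "r < l j" for j
    by (simp add: l_def)
  have l_pos: "0 < l j" for j
    using l_gr[of j] r_pos by simp
  have l_lim: "l \<longlonglongrightarrow> r + 0"
    unfolding l_def by (intro tendsto_intros tendsto_inverse_Suc)
  have "\<exists>x. l j *\<^sub>R x = g x + w \<and> (\<forall>n. cone_le C (affine_iter (l j) w n) x)" for j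
  proof -
    have "cone_spectral_radius C g < ennreal (l j)"
      using r(2) l_gr[of j] r_pos by (simp add: ennreal_less_iff)
    then show ?thesis
      using affine_iter_fixpoint[of "l j" w] l_gr[of j] l_pos[of j] r(1) w by (metis less_trans)
  qed
  then obtain x where x: "\<And>j. l j *\<^sub>R x j = g (x j) + w"
    "\<And>j n. cone_le C (affine_iter (l j) w n) (x j)"
    by metis
  have xC: "x j \<in> C" for j
    using x(2)[of j 0] by (simp add: le_zero)
  \<comment> \<open>If a tail of the solutions were bounded, \<open>affine_iter_ge\<close> would
    bound \<open>(1 / l j) ^ Suc n *\<^sub>R (g ^^ n) w\<close> uniformly in \<open>j\<close> and
    \<open>n\<close>. Letting \<open>l j\<close> tend to \<open>r\<close> contradicts
    \<open>unb\<close>.\<close>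
  have "\<exists>j\<ge>i. B \<le> norm (x j)" for B i
  proof (rule ccontr)
    assume "\<not> (\<exists>j\<ge>i. B \<le> norm (x j))"
    then have B: "norm (x j) \<le> B" if "j \<ge> i" for j
      using that by fastforce
    have "norm ((1 / r) ^ n *\<^sub>R (g ^^ n) w) \<le> M * B * r" for n
    proof -
      have "norm ((1 / l j) ^ Suc n *\<^sub>R (g ^^ n) w) \<le> M * B" if "j \<ge> i" for j
      proof -
        have "cone_le C ((1 / l j) ^ Suc n *\<^sub>R (g ^^ n) w) (x j)"
          using affine_iter_ge[OF l_pos w] x(2) le_trans by blast
        then have "norm ((1 / l j) ^ Suc n *\<^sub>R (g ^^ n) w) \<le> M * norm (x j)"
          using l_pos[of j] w by (intro norm_mono cone_scaleR funpow_cone) auto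
        also have "\<dots> \<le> M * B"
          using B[OF that] M_ge_1 by (intro mult_left_mono) auto
        finally show ?thesis .
      qed
      moreover have "(\<lambda>j. norm ((1 / l j) ^ Suc n *\<^sub>R (g ^^ n) w))
          \<longlonglongrightarrow> norm ((1 / (r + 0)) ^ Suc n *\<^sub>R (g ^^ n) w)"
        using l_lim r_pos by (intro tendsto_intros) auto
      ultimately have "norm ((1 / r) ^ Suc n *\<^sub>R (g ^^ n) w) \<le> M * B"
        using Lim_bounded[of _ _ i "M * B"] by (simp only: add_0_right) blast
      then show ?thesis
        using r_pos by (simp add: field_simps)
    qed
    then have "bounded (range (\<lambda>n. (1 / r) ^ n *\<^sub>R (g ^^ n) w))"
      unfolding bounded_iff by blast
    with unb show False by simp
  qed
  then have "\<forall>i. \<exists>j\<ge>i. real i + 1 \<le> norm (x j)"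
    by blast
  \<comment> \<open>\<open>\<psi>\<close> need not be monotone; \<open>\<psi> i \<ge> i\<close>
    already forces \<open>l (\<psi> i)\<close> to tend to \<open>r\<close>.\<close>
  then obtain \<psi> where \<psi>: "\<And>i. \<psi> i \<ge> i" "\<And>i. real i + 1 \<le> norm (x (\<psi> i))"
    by metis
  define s where "s i = 1 / norm (x (\<psi> i))" for i
  define y where "y i = s i *\<^sub>R x (\<psi> i)" for i
  have s: "0 \<le> s i" "s i \<le> 1" "s i \<le> 1 / (real i + 1)" for i
    using \<psi>(2)[of i] unfolding s_def by (simp_all add: divide_le_eq_1 frac_le)
  have "0 < norm (x (\<psi> i))" for i
    using \<psi>(2)[of i] by linarith
  then have norm_y: "norm (y i) = 1" for i
    by (simp add: y_def s_def)
  have yC: "y i \<in> C" for i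
    unfolding y_def using xC s by (intro cone_scaleR)
  have y_eq: "l (\<psi> i) *\<^sub>R y i = g (y i) + s i *\<^sub>R w" for i
    using s(1)[of i] by (simp add: y_def map_scaleR mult.commute flip: x(1) scaleR_add_right)
  have "compact (closure (range y))"
  proof (rule precompact[OF _ _ _ r(1)])
    show "bounded (range y)"
      unfolding bounded_iff using norm_y by auto
    show "range y \<subseteq> C"
      using yC by blast
    show "compact ((\<lambda>t. t *\<^sub>R w) ` {0..1})"
      by (intro compact_continuous_image continuous_intros) simp
    fix z assume "z \<in> range y"
    then obtain i where i: "z = y i" by blast
    have "s i *\<^sub>R w \<in> (\<lambda>t. t *\<^sub>R w) ` {0..1}"
      using s(1,2)[of i] by (intro imageI) simp
    \<comment> \<open>Each \<open>y i\<close> is its own predecessor, with factor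
      \<open>l (\<psi> i) > r\<close>.\<close>
    then show "z = 0 \<or> (\<exists>y'\<in>range y. \<exists>z'\<in>(\<lambda>t. t *\<^sub>R w) ` {0..1}. \<exists>m\<ge>r. m *\<^sub>R z = g y' + z')"
      unfolding i using y_eq[of i] l_gr[of "\<psi> i"]
      by (intro disjI2 bexI[of _ "y i"] bexI[of _ "s i *\<^sub>R w"] exI[of _ "l (\<psi> i)"] conjI)
        (simp_all add: less_imp_le)
  qed
  moreover have "\<forall>i. y i \<in> closure (range y)"
    using closure_subset[of "range y"] by blast
  ultimately obtain v \<phi> where \<phi>: "strict_mono \<phi>" "(y \<circ> \<phi>) \<longlonglongrightarrow> v"
    using seq_compactE[of "closure (range y)" y] unfolding compact_eq_seq_compact_metric by blast
  have "v \<in> C"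
    by (rule closed_sequentially[OF closed_cone _ \<phi>(2)]) (simp add: yC)
  moreover have "norm v = 1"
    using tendsto_norm[OF \<phi>(2)] norm_y by (simp add: o_def LIMSEQ_const_iff)
  then have "v \<noteq> 0"
    by auto
  moreover have "g v = r *\<^sub>R v"
  proof -
    have "filterlim \<psi> at_top sequentially"
      using \<psi>(1) by (intro filterlim_at_top_mono[OF filterlim_ident]) auto
    then have "(\<lambda>i. l (\<psi> i)) \<longlonglongrightarrow> r"
      using filterlim_compose[OF l_lim] by simp
    then have lim1: "(\<lambda>i. l (\<psi> (\<phi> i)) *\<^sub>R y (\<phi> i)) \<longlonglongrightarrow> r *\<^sub>R v"
      using \<phi> by (intro tendsto_scaleR) (auto simp: o_def dest: LIMSEQ_subseq_LIMSEQ)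
    have "s \<longlonglongrightarrow> 0"
      using tendsto_inverse_Suc by (rule Lim_null_comparison[rotated]) (use s in simp)
    then have lim2: "(\<lambda>i. g (y (\<phi> i)) + s (\<phi> i) *\<^sub>R w) \<longlonglongrightarrow> g v + 0 *\<^sub>R w"
      using \<phi> by (intro tendsto_add map_tendsto tendsto_scaleR tendsto_const)
        (auto simp: o_def dest: LIMSEQ_subseq_LIMSEQ)
    show ?thesis
      using LIMSEQ_unique[OF lim1[unfolded y_eq] lim2] by simp
  qed
  ultimately show ?thesis
    using that by blast
qed

text \<open>The supremum defining \<open>r\<close> need not be attained, so each
  \<open>l j < r\<close> gets its own vector of growth rate above \<open>l j\<close>.
  \<open>superharmonic_limit\<close> merges the resulting unbounded iterations into one
  \<open>w\<close>, whose rescaled orbit is either bounded or not.\<close>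

lemma eigenvector_spectral_radius:
  assumes r: "k < r" "cone_spectral_radius C g = ennreal r"
  obtains x where "x \<in> C" "x \<noteq> 0" "g x = r *\<^sub>R x"
proof -
  \<comment> \<open>The midpoint keeps all \<open>l j\<close> above one bound exceeding
    \<open>k\<close>, as needed for precompactness; \<open>l 0\<close> equals
    \<open>l0\<close>.\<close>
  define l0 where "l0 = (k + r) / 2"
  define l where "l j = r - (r - l0) * (1 / (real j + 1))" for j
  have l0: "k < l0" "l0 < r"
    using r(1) by (auto simp: l0_def)
  have l: "l0 \<le> l j" "l j < r" for j
    using l0(2) mult_left_le[of "1 / (real j + 1)" "r - l0"] by (simp_all add: l_def)
  have l_lim: "l \<longlonglongrightarrow> r - (r - l0) * 0"
    unfolding l_def by (intro tendsto_intros tendsto_inverse_Suc)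
  \<comment> \<open>The \<open>u\<close> depends on \<open>j\<close>; making it tend to \<open>0\<close> puts all of them into one compact set.\<close>
  have "\<exists>u\<in>C. norm u \<le> 1 / (real j + 1) \<and> \<not> bounded (range (affine_iter (l j) u))" for j
  proof -
    let ?G = "\<lambda>x. limsup (\<lambda>k. ennreal (root k (norm ((g ^^ k) x))))"
    have "ennreal (l j) < cone_spectral_radius C g"
      using r(2) l[of j] l0 k_pos by (simp add: ennreal_less_iff)
    then obtain u where u: "u \<in> C" "ennreal (l j) < ?G u"
      unfolding cone_spectral_radius_def less_SUP_iff by blast
    \<comment> \<open>Positive scaling does not change the growth rate, so \<open>u\<close> may be
      shrunk to norm at most \<open>1 / (real j + 1)\<close>.\<close>
    define t where "t = 1 / ((real j + 1) * (norm u + 1))"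
    have t: "0 < t"
      by (simp add: t_def add_nonneg_pos)
    have "norm ((g ^^ n) u) \<le> 1 / t * norm ((g ^^ n) (t *\<^sub>R u))" for n
      using t by (simp add: funpow_scaleR)
    then have "?G u \<le> ?G (t *\<^sub>R u)"
      using t by (intro limsup_root_mono[where M = "1 / t"]) auto
    then have "ennreal (l j) < ?G (t *\<^sub>R u)"
      using u(2) by simp
    then have "\<not> bounded (range (affine_iter (l j) (t *\<^sub>R u)))"
      using l[of j] l0 k_pos u(1) t by (intro affine_iter_unbounded cone_scaleR) auto
    moreover have "norm (t *\<^sub>R u) \<le> 1 / (real j + 1)"
      by (simp add: t_def divide_simps add_nonneg_pos)
    ultimately show ?thesis
      using cone_scaleR[OF u(1), of t] t by (intro bexI[of _ "t *\<^sub>R u"]) auto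
  qed
  then obtain u where u: "\<And>j. u j \<in> C" "\<And>j. norm (u j) \<le> 1 / (real j + 1)"
    "\<And>j. \<not> bounded (range (affine_iter (l j) (u j)))"
    by metis
  have "u \<longlonglongrightarrow> 0"
    using tendsto_inverse_Suc by (rule Lim_null_comparison[rotated]) (use u(2) in simp)
  then have "compact (insert 0 (range u))"
    by (rule compact_insert_range)
  moreover have "insert 0 (range u) \<subseteq> C"
    using u(1) cone_zero by blast
  ultimately obtain w where w: "w \<in> C" "w \<noteq> 0" "cone_le C (r *\<^sub>R w) (g w)"
    using superharmonic_limit[of l0 l r "insert 0 (range u)" u] l(1) l0(1) l_lim u(3) by auto
  show ?thesis
  proof (cases "bounded (range (\<lambda>n. (1 / r) ^ n *\<^sub>R (g ^^ n) w))")
    case True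
    with r(1) w show ?thesis
      using bounded_iteration_eigenvector that by blast
  next
    case False
    with r w(1) show ?thesis
      using unbounded_iteration_eigenvector that by blast
  qed
qed

end

section \<open>Families with an upper selection\<close>

theorem proposition8p1:
  fixes C :: "'a::banach set"
    and A :: "'i set"
    and F :: "'i \<Rightarrow> 'a \<Rightarrow> 'a"
    and f :: "'a \<Rightarrow> 'a"
    and nu :: "'a set \<Rightarrow> real"
  assumes "proper_cone C"
    and "homogeneous_gmnc nu"
    and "\<forall>a\<in>A. homogeneous (F a)"
    and "admits_upper_selection C A F"
    and "f = family_sup C A F"
  shows "homogeneous f \<and>
    cone_eigenvalue_radius C f \<le> (SUP a\<in>A. cone_eigenvalue_radius C (F a)) \<and>
    ((\<forall>a\<in>A. continuous_on UNIV (F a) \<and> order_preserving C (F a)) \<and>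
      continuous_on UNIV f \<and> normal_cone C \<longrightarrow>
      order_preserving C f \<and>
      (SUP a\<in>A. cone_spectral_radius C (F a)) \<le> cone_spectral_radius C f \<and>
      cone_spectral_radius C f
        \<le> max (cone_nu nu C f) (SUP a\<in>A. cone_spectral_radius C (F a)) \<and>
      (cone_nu nu C f < cone_spectral_radius C f \<longrightarrow>
        cone_eigenvalue_radius C f = (SUP a\<in>A. cone_eigenvalue_radius C (F a)) \<and>
        (SUP a\<in>A. cone_eigenvalue_radius C (F a)) = (SUP a\<in>A. cone_spectral_radius C (F a)) \<and>
        (SUP a\<in>A. cone_spectral_radius C (F a)) = cone_spectral_radius C f \<and>
        (\<exists>a\<in>A. cone_eigenvalue_radius C (F a) = (SUP b\<in>A. cone_eigenvalue_radius C (F b))) \<and>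
        (\<exists>a\<in>A. cone_spectral_radius C (F a) = (SUP b\<in>A. cone_spectral_radius C (F b)))))"
proof -
  note C = assms(1)
  have sel: "\<exists>a\<in>A. f x = F a x \<and> (\<forall>b\<in>A. cone_le C (F b x) (f x))" for x
  proof -
    have "\<exists>a. a \<in> A \<and> (\<forall>b\<in>A. cone_le C (F b x) (F a x))"
      using assms(4) unfolding admits_upper_selection_def by blast
    from someI_ex[OF this] show ?thesis
      unfolding assms(5) family_sup_def by blast
  qed
  have upper: "cone_le C (F b x) (f x)" if "b \<in> A" for b x
    using sel that by blast

  have hom_f: "homogeneous f"
    unfolding homogeneous_def
  proof (intro allI impI)
    fix t :: real and x :: 'a
    assume t: "0 < t"
    obtain a where a: "a \<in> A" "f (t *\<^sub>R x) = F a (t *\<^sub>R x)"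
      using sel by blast
    obtain b where b: "b \<in> A" "f x = F b x"
      using sel by blast
    have hom: "F c (t *\<^sub>R x) = t *\<^sub>R F c x" if "c \<in> A" for c
      using assms(3) that t unfolding homogeneous_def by blast
    show "f (t *\<^sub>R x) = t *\<^sub>R f x"
    \<comment> \<open>The indices selected at \<open>x\<close> and at \<open>t *\<^sub>R x\<close>
      may differ, so each of them yields one of the two inequalities.\<close>
    proof (rule cone_le_antisym[OF C])
      show "cone_le C (f (t *\<^sub>R x)) (t *\<^sub>R f x)"
        using cone_le_scaleR[OF C upper[OF a(1)], of t x] hom[OF a(1)] a(2) t by simp
      show "cone_le C (t *\<^sub>R f x) (f (t *\<^sub>R x))"
        using upper[OF b(1), of "t *\<^sub>R x"] hom[OF b(1)] b(2) by simp
    qed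
  qed

  \<comment> \<open>Naming a single index, rather than bounding by the supremum, is what later gives
    attainment.\<close>
  have eigen: "\<exists>a\<in>A. ennreal l \<le> cone_eigenvalue_radius C (F a)"
    if x: "x \<in> C" "x \<noteq> 0" "0 \<le> l" "f x = l *\<^sub>R x" for x l
  proof -
    obtain a where "a \<in> A" "F a x = l *\<^sub>R x"
      using sel[of x] x(4) by auto
    then show ?thesis
      using x(1-3) unfolding cone_eigenvalue_radius_def by (blast intro: Sup_upper)
  qed
  have eig_f: "cone_eigenvalue_radius C f \<le> (SUP a\<in>A. cone_eigenvalue_radius C (F a))"
    unfolding cone_eigenvalue_radius_def[of C f]
  proof (rule Sup_least)
    fix e assume "e \<in> ennreal ` {l. 0 \<le> l \<and> (\<exists>x\<in>C - {0}. f x = l *\<^sub>R x)}"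
    then show "e \<le> (SUP a\<in>A. cone_eigenvalue_radius C (F a))"
      using eigen by (blast intro: SUP_upper2)
  qed

  show ?thesis
  proof (intro conjI impI; (rule hom_f eig_f)?)
    assume "(\<forall>a\<in>A. continuous_on UNIV (F a) \<and> order_preserving C (F a)) \<and>
      continuous_on UNIV f \<and> normal_cone C"
    then have cont_F: "\<And>a. a \<in> A \<Longrightarrow> continuous_on UNIV (F a)"
      and mono_F: "\<And>a. a \<in> A \<Longrightarrow> order_preserving C (F a)"
      and cont_f: "continuous_on UNIV f" and normal: "normal_cone C"
      by blast+
    have mono_f: "order_preserving C f"
      unfolding order_preserving_def
    proof (intro allI impI)
      fix x y assume xy: "cone_le C x y"
      obtain a where a: "a \<in> A" "f x = F a x"
        using sel by blast
      have "cone_le C (F a x) (F a y)"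
        using mono_F[OF a(1)] xy unfolding order_preserving_def by blast
      then show "cone_le C (f x) (f y)"
        using cone_le_trans[OF C _ upper[OF a(1)]] a(2) by simp
    qed
    obtain M where "normal_proper_cone C M"
      using normal by (rule normal_cone_locale)
    then interpret normal_proper_cone C M .
    interpret f: cone_map C M f
      by unfold_locales (rule hom_f mono_f cont_f)+
    have F: "cone_map C M (F a)" if "a \<in> A" for a
      using assms(3) mono_F cont_F that by unfold_locales blast+

    have spec_F_le: "cone_spectral_radius C (F a) \<le> cone_spectral_radius C f" if "a \<in> A" for a
      using cone_map.map_cone[OF F[OF that]] upper[OF that] by (rule f.spectral_radius_mono)
    have eig_F_le: "cone_eigenvalue_radius C (F a) \<le> cone_spectral_radius C (F a)" if "a \<in> A" for a
      using F[OF that] by (rule cone_map.eigenvalue_radius_le_spectral_radius)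
    have spec_f: "(SUP a\<in>A. cone_spectral_radius C (F a)) \<le> cone_spectral_radius C f"
      using spec_F_le by (rule SUP_least)
    have attained: "\<exists>a\<in>A. cone_spectral_radius C f \<le> cone_eigenvalue_radius C (F a)"
      and eig_ge: "cone_spectral_radius C f \<le> cone_eigenvalue_radius C f"
      if "cone_nu nu C f < cone_spectral_radius C f"
    proof -
      \<comment> \<open>An infimum below the spectral radius leaves room for an admissible factor
        \<open>k\<close> below it, and \<open>k\<close> takes the place of
        \<open>cone_nu nu C f\<close>.\<close>
      obtain k where k: "0 < k" "ennreal k < cone_spectral_radius C f"
        "\<And>S. bounded S \<Longrightarrow> S \<subseteq> C \<Longrightarrow> nu (f ` S) \<le> k * nu S"
        using \<open>cone_nu nu C f < cone_spectral_radius C f\<close>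
        unfolding cone_nu_def Inf_less_iff by blast
      obtain r where r: "cone_spectral_radius C f = ennreal r" "0 \<le> r"
        using f.spectral_radius_finite by (cases "cone_spectral_radius C f") auto
      interpret condensing_cone_map C M f nu k
        by unfold_locales (use assms(2) k in auto)
      obtain x where x: "x \<in> C" "x \<noteq> 0" "f x = r *\<^sub>R x"
        using eigenvector_spectral_radius[of r] k(1,2) r by (auto simp: ennreal_less_iff)
      show "\<exists>a\<in>A. cone_spectral_radius C f \<le> cone_eigenvalue_radius C (F a)"
        using eigen[OF x(1,2) r(2) x(3)] r(1) by simp
      show "cone_spectral_radius C f \<le> cone_eigenvalue_radius C f"
        unfolding r(1) cone_eigenvalue_radius_def using x r(2) by (blast intro: Sup_upper)
    qed

    show "order_preserving C f"
      by (rule mono_f)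
    show "(SUP a\<in>A. cone_spectral_radius C (F a)) \<le> cone_spectral_radius C f"
      by (rule spec_f)
    show "cone_spectral_radius C f
        \<le> max (cone_nu nu C f) (SUP a\<in>A. cone_spectral_radius C (F a))"
    proof (cases "cone_nu nu C f < cone_spectral_radius C f")
      case True
      then obtain a where "a \<in> A" "cone_spectral_radius C f \<le> cone_eigenvalue_radius C (F a)"
        using attained by blast
      then show ?thesis
        using eig_F_le by (blast intro: SUP_upper2 order.trans max.coboundedI2)
    qed (simp add: max.coboundedI1)

    assume *: "cone_nu nu C f < cone_spectral_radius C f"
    let ?r = "cone_spectral_radius C f"
    obtain a where a: "a \<in> A" "?r \<le> cone_eigenvalue_radius C (F a)"
      using attained[OF *] by blast
    \<comment> \<open>For this \<open>a\<close> the chain from \<open>?r\<close> through the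
      eigenvalue radius and the spectral radius of \<open>F a\<close> back to \<open>?r\<close>
      collapses to equalities.\<close>
    have eig_a: "cone_eigenvalue_radius C (F a) = ?r" and spec_a: "cone_spectral_radius C (F a) = ?r"
      using a(2) eig_F_le[OF a(1)] spec_F_le[OF a(1)] by auto
    have sup_eig: "(SUP a\<in>A. cone_eigenvalue_radius C (F a)) = ?r"
      using a eig_F_le spec_F_le by (intro antisym SUP_least SUP_upper2[OF a(1)]) (auto intro: order.trans)
    have sup_spec: "(SUP a\<in>A. cone_spectral_radius C (F a)) = ?r"
      using spec_f by (intro antisym SUP_upper2[OF a(1)]) (auto simp: spec_a)
    show "cone_eigenvalue_radius C f = (SUP a\<in>A. cone_eigenvalue_radius C (F a))"
      unfolding sup_eig using f.eigenvalue_radius_le_spectral_radius eig_ge[OF *] by (rule antisym)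
    show "(SUP a\<in>A. cone_eigenvalue_radius C (F a)) = (SUP a\<in>A. cone_spectral_radius C (F a))"
      by (simp only: sup_eig sup_spec)
    show "(SUP a\<in>A. cone_spectral_radius C (F a)) = ?r"
      by (rule sup_spec)
    show "\<exists>a\<in>A. cone_eigenvalue_radius C (F a) = (SUP b\<in>A. cone_eigenvalue_radius C (F b))"
      unfolding sup_eig using a(1) eig_a by blast
    show "\<exists>a\<in>A. cone_spectral_radius C (F a) = (SUP b\<in>A. cone_spectral_radius C (F b))"
      unfolding sup_spec using a(1) spec_a by blast
  qed
qed

end
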